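(* Let $p$ be an odd prime and let $k$ be a field of characteristic $p$. Let $g \in k[[\zeta]]$ be a power series of the form $$g(\zeta) = \zeta\left(1 + \sum_{j=1}^{+\infty} a_j\zeta^j\right).$$ Then $g$ is $2$-ramified if and only if $a_1 = 0$, $a_2 \neq 0$ and $$\tfrac{3}{2}a_2^3 + a_3^2 - a_2a_4 \neq 0.$$
   Context: The order $\mathrm{ord}(h)$ of a nonzero power series $h \in k[[\zeta]]$ is the lowest degree of its nonzero terms, and $\mathrm{ord}(0) := +\infty$. For a power series $g(\zeta) = \zeta + \cdots \in k[[\zeta]]$ (i.e. $g(0)=0$ and linear coefficient $1$), $g^n$ denotes the $n$-fold composition of $g$ with itself. For integers $n \geq 0$ the lower ramification number of $g$ is $$i_n(g) := \mathrm{ord}\left(\frac{g^{p^n}(\zeta)-\zeta}{\zeta}\right).$$ The series $g$ is called $2$-ramified if $i_n(g) = 2(1+p+\cdots+p^n)$ for all integers $n \geq 0$. *)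

theory Defs
  imports
    "HOL-Computational_Algebra.Computational_Algebra"
    "HOL-Library.Extended_Nat"
begin

text \<open>Unlike \<^const>\<open>subdegree\<close>, which is \<open>0\<close> at the zero series, the order of the zero series
  is infinite.\<close>

definition fps_ord :: "'a::zero fps \<Rightarrow> enat" where
  "fps_ord h = (if h = 0 then \<infinity> else enat (subdegree h))"

text \<open>The \<open>n\<close>-fold composition of \<open>g\<close> with itself; meaningful for series with zero constant term.\<close>

primrec fps_iterate :: "nat \<Rightarrow> 'a::comm_ring_1 fps \<Rightarrow> 'a fps" where
  "fps_iterate 0 g = fps_X"
| "fps_iterate (Suc n) g = g oo fps_iterate n g"

text \<open>The parameter \<open>p\<close> is intended to be the characteristic of the coefficient field.\<close>

definition lower_ramification_number :: "nat \<Rightarrow> nat \<Rightarrow> 'a::field fps \<Rightarrow> enat" where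
  "lower_ramification_number p n g = fps_ord ((fps_iterate (p ^ n) g - fps_X) / fps_X)"

definition two_ramified :: "nat \<Rightarrow> 'a::field fps \<Rightarrow> bool" where
  "two_ramified p g \<longleftrightarrow>
     (\<forall>n. lower_ramification_number p n g = enat (2 * (\<Sum>i\<le>n. p ^ i)))"

end

(* Let T f = f o g - f. In characteristic p, T^p f = f o g^p - f. If
   g = x + A x^(d+1) + B x^(d+2) + C x^(d+3) + ... with d = 2 in the field, apply T repeatedly
   to f = (x + (B/A) x^2)^2, a choice for which the second coefficient of T^j f is always
   proportional to the first. After p steps the factors that vanish mod p leave the order of
   g^p - x at least pd + 3, with equality iff D = B^2 - AC + [d = 2] (3/2) A^3 is nonzero.
   Comparing three coefficients in g o g^p = g^p o g shows that D for g^p is a nonzero multiple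
   of D for g, so the condition propagates from level d to level pd + 2. *)

theory Submission
  imports Defs
begin

section \<open>The difference operator and its lowest coefficients\<close>

definition fps_delta :: "'a::comm_ring_1 fps \<Rightarrow> 'a fps \<Rightarrow> 'a fps" where
  "fps_delta g f = (f oo g) - f"

text \<open>Three terms suffice: if s starts in degree d \<ge> 2, then s^3 starts in degree 3d > d +
  2, beyond every coefficient examined below.\<close>

lemma one_plus_power_expand:
  fixes s :: "'a::comm_ring_1"
  shows "\<exists>q. (1 + s) ^ k = 1 + of_nat k * s + of_nat (k choose 2) * s ^ 2 + s ^ 3 * q"
proof (induction k)
  case 0
  show ?case by (rule exI[of _ 0]) (simp add: numeral_2_eq_2)
next
  case (Suc k)
  then obtain q where q: "(1 + s) ^ k = 1 + of_nat k * s + of_nat (k choose 2) * s ^ 2 + s ^ 3 * q"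
    by blast
  have c: "of_nat (Suc k choose 2) = (of_nat k + of_nat (k choose 2) :: 'a)"
    by (simp add: numeral_2_eq_2)
  have "(1 + s) ^ Suc k = (1 + s) * (1 + of_nat k * s + of_nat (k choose 2) * s ^ 2 + s ^ 3 * q)"
    using q by simp
  also have "\<dots> = 1 + of_nat (Suc k) * s + of_nat (Suc k choose 2) * s ^ 2
      + s ^ 3 * (of_nat (k choose 2) + (1 + s) * q)"
    unfolding c by (simp add: algebra_simps power2_eq_square power3_eq_cube)
  finally show ?case by blast
qed

text \<open>The square of s starts in degree 2d, which is at most d + 2 only for d = 2 once d \<ge>
  2. This is the origin of every case distinction on \<open>d = 2\<close> that follows.\<close>

lemma fps_one_plus_power_nth:
  fixes s :: "'a::comm_ring_1 fps"
  assumes "d \<ge> 1" and s: "\<forall>j<d. s $ j = 0"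
  shows "n < d \<Longrightarrow> ((1 + s) ^ k - 1) $ n = 0"
    and "((1 + s) ^ k - 1) $ d = of_nat k * s $ d"
    and "d \<ge> 2 \<Longrightarrow> ((1 + s) ^ k - 1) $ (d + 1) = of_nat k * s $ (d + 1)"
    and "d \<ge> 2 \<Longrightarrow> ((1 + s) ^ k - 1) $ (d + 2) =
      of_nat k * s $ (d + 2) + (if d = 2 then of_nat (k choose 2) * (s $ d) ^ 2 else 0)"
proof -
  obtain q where q: "(1 + s) ^ k = 1 + of_nat k * s + of_nat (k choose 2) * s ^ 2 + s ^ 3 * q"
    using one_plus_power_expand[of s k] by blast
  define r where "r = fps_shift d s"
  have sr: "s = fps_X ^ d * r"
    unfolding r_def using s by (intro fps_ext) (simp add: fps_X_power_mult_nth)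
  have r0: "r $ 0 = s $ d" by (simp add: r_def)
  have *: "((1 + s) ^ k - 1) $ n = of_nat k * s $ n
      + (if n < 2 * d then 0 else of_nat (k choose 2) * (r ^ 2) $ (n - 2 * d))
      + (if n < 3 * d then 0 else (r ^ 3 * q) $ (n - 3 * d))" for n
  proof -
    have e: "(1 + s) ^ k - 1 = of_nat k * s + fps_X ^ (2 * d) * (of_nat (k choose 2) * r ^ 2)
        + fps_X ^ (3 * d) * (r ^ 3 * q)"
      unfolding q unfolding sr by (simp add: power_mult_distrib power_mult[symmetric] mult_ac)
    show ?thesis
      unfolding e by (simp add: fps_X_power_mult_nth fps_mult_of_nat_nth)
  qed
  show "n < d \<Longrightarrow> ((1 + s) ^ k - 1) $ n = 0"
    unfolding * using s by simp
  show "((1 + s) ^ k - 1) $ d = of_nat k * s $ d"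
    unfolding * using assms(1) by simp
  show "((1 + s) ^ k - 1) $ (d + 1) = of_nat k * s $ (d + 1)" if "d \<ge> 2"
    unfolding * using that by simp
  show "((1 + s) ^ k - 1) $ (d + 2) =
      of_nat k * s $ (d + 2) + (if d = 2 then of_nat (k choose 2) * (s $ d) ^ 2 else 0)" if "d \<ge> 2"
    unfolding * using that by (auto simp: power2_eq_square r0)
qed

lemma fps_delta_nth:
  fixes f s :: "'a::comm_ring_1 fps"
  shows "fps_delta (fps_X * (1 + s)) f $ n = (\<Sum>i\<le>n. f $ i * ((1 + s) ^ i - 1) $ (n - i))"
proof -
  have "fps_delta (fps_X * (1 + s)) f = (f oo fps_X * (1 + s)) - (f oo fps_X)"
    by (simp add: fps_delta_def)
  also have "\<dots> $ n = (\<Sum>i\<le>n. f $ i * ((fps_X * (1 + s)) ^ i - fps_X ^ i) $ n)"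
    unfolding fps_sub_nth fps_compose_nth atLeast0AtMost right_diff_distrib sum_subtractf ..
  also have "\<dots> = (\<Sum>i\<le>n. f $ i * ((1 + s) ^ i - 1) $ (n - i))"
  proof (rule sum.cong)
    fix i assume "i \<in> {..n}"
    moreover have "(fps_X * (1 + s)) ^ i - fps_X ^ i = fps_X ^ i * ((1 + s) ^ i - 1)"
      by (simp only: power_mult_distrib right_diff_distrib mult_1_right)
    ultimately show "f $ i * ((fps_X * (1 + s)) ^ i - fps_X ^ i) $ n = f $ i * ((1 + s) ^ i - 1) $ (n - i)"
      by (simp add: fps_X_power_mult_nth del: fps_sub_nth)
  qed simp
  finally show ?thesis .
qed

text \<open>The operator sends X^i to X^i ((1 + s)^i - 1), of order at least i + d, so only the
  coefficients of f at m, m + 1 and m + 2 can reach degree m + d + 2. The factors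
  \<open>of_nat m\<close>, \<open>of_nat (m + 1)\<close>, \<open>of_nat (m + 2)\<close> are what
  later vanishes in characteristic p.\<close>

lemma fps_delta_leading:
  fixes f g :: "'a::comm_ring_1 fps"
  assumes "d \<ge> 1" and g: "\<forall>j\<le>d. (g - fps_X) $ j = 0"
    and f: "\<forall>j<m. f $ j = 0"
  shows "n < m + d \<Longrightarrow> fps_delta g f $ n = 0"
    and "fps_delta g f $ (m + d) = of_nat m * f $ m * g $ (d + 1)"
    and "d \<ge> 2 \<Longrightarrow> fps_delta g f $ (m + d + 1) =
      of_nat m * f $ m * g $ (d + 2) + of_nat (m + 1) * f $ (m + 1) * g $ (d + 1)"
    and "d \<ge> 2 \<Longrightarrow> fps_delta g f $ (m + d + 2) =
      of_nat m * f $ m * g $ (d + 3) + of_nat (m + 1) * f $ (m + 1) * g $ (d + 2)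
      + of_nat (m + 2) * f $ (m + 2) * g $ (d + 1)
      + (if d = 2 then of_nat (m choose 2) * f $ m * (g $ (d + 1)) ^ 2 else 0)"
proof -
  define s where "s = fps_shift 1 (g - fps_X)"
  have "g - fps_X = fps_X * s"
    unfolding s_def using g by (intro fps_ext) (simp del: fps_sub_nth)
  then have gs: "g = fps_X * (1 + s)" by (simp add: algebra_simps)
  have s0: "\<forall>j<d. s $ j = 0" using g unfolding s_def by (simp del: fps_sub_nth)
  have sg: "s $ j = g $ (j + 1)" if "j \<ge> 1" for j
    using that by (simp add: s_def)
  note c = fps_one_plus_power_nth[OF \<open>d \<ge> 1\<close> s0]
  have *: "fps_delta g f $ (m + d + t) = (\<Sum>i\<le>t. f $ (m + i) * ((1 + s) ^ (m + i) - 1) $ (d + t - i))" for t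
  proof -
    have "fps_delta g f $ (m + d + t) = (\<Sum>i\<le>m + d + t. f $ i * ((1 + s) ^ i - 1) $ (m + d + t - i))"
      unfolding gs fps_delta_nth ..
    \<comment> \<open>Terms with i < m vanish because f starts in degree m, those with i > m + t
      because the second index drops below d.\<close>
    also have "\<dots> = (\<Sum>i\<in>{m..m + t}. f $ i * ((1 + s) ^ i - 1) $ (m + d + t - i))"
      using f c(1) by (intro sum.mono_neutral_right) (auto simp del: fps_sub_nth)
    also have "\<dots> = (\<Sum>i\<le>t. f $ (m + i) * ((1 + s) ^ (m + i) - 1) $ (d + t - i))"
      by (rule sum.reindex_bij_witness[of _ "\<lambda>i. m + i" "\<lambda>i. i - m"])
         (auto simp: add_ac simp del: fps_sub_nth)
    finally show ?thesis .
  qed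
  show "fps_delta g f $ n = 0" if "n < m + d"
    unfolding gs fps_delta_nth
  proof (rule sum.neutral, rule ballI)
    fix i assume "i \<in> {..n}"
    with that have "i < m \<or> n - i < d" by auto
    then show "f $ i * ((1 + s) ^ i - 1) $ (n - i) = 0" using f c(1) by (auto simp del: fps_sub_nth)
  qed
  show "fps_delta g f $ (m + d) = of_nat m * f $ m * g $ (d + 1)"
    using *[of 0] c(2) sg[of d] \<open>d \<ge> 1\<close> by (simp add: mult_ac del: fps_sub_nth)
  assume d2: "d \<ge> 2"
  have s3: "(\<Sum>i\<le>2. h i) = h 0 + h 1 + h 2" for h :: "nat \<Rightarrow> 'a"
    by (simp add: numeral_2_eq_2)
  have sg': "s $ d = g $ (d + 1)" "s $ (d + 1) = g $ (d + 2)" "s $ (d + 2) = g $ (d + 3)"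
    using \<open>d \<ge> 1\<close> by (simp_all add: sg numeral_eq_Suc)
  have s2: "(\<Sum>i\<le>1. h i) = h 0 + h 1" for h :: "nat \<Rightarrow> 'a" by simp
  have idx: "d + 2 - 0 = d + 2" "d + 2 - 1 = d + 1" "d + 2 - 2 = d"
    "d + 1 - 0 = d + 1" "d + 1 - 1 = d" by simp_all
  show "fps_delta g f $ (m + d + 1) =
      of_nat m * f $ m * g $ (d + 2) + of_nat (m + 1) * f $ (m + 1) * g $ (d + 1)"
    unfolding * s2 idx c(2) c(3)[OF d2] sg' add_0_right
    by (simp add: algebra_simps)
  show "fps_delta g f $ (m + d + 2) =
      of_nat m * f $ m * g $ (d + 3) + of_nat (m + 1) * f $ (m + 1) * g $ (d + 2)
      + of_nat (m + 2) * f $ (m + 2) * g $ (d + 1)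
      + (if d = 2 then of_nat (m choose 2) * f $ m * (g $ (d + 1)) ^ 2 else 0)"
    unfolding * s3 idx c(2) c(3)[OF d2] c(4)[OF d2] sg' add_0_right
    by (simp add: algebra_simps)
qed

section \<open>Iterates and powers of the difference operator\<close>

lemma fps_iterate_nth_0:
  fixes g :: "'a::comm_ring_1 fps"
  assumes "g $ 0 = 0"
  shows "fps_iterate n g $ 0 = 0"
  using assms by (cases n) simp_all

lemma fps_iterate_nth_1:
  fixes g :: "'a::comm_ring_1 fps"
  assumes "g $ 1 = 1"
  shows "fps_iterate n g $ 1 = 1"
  using assms by (induction n) (simp_all add: fps_compose_nth)

lemma fps_iterate_add:
  fixes g :: "'a::idom fps"
  assumes "g $ 0 = 0"
  shows "fps_iterate (m + n) g = fps_iterate m g oo fps_iterate n g"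
  by (induction m)
     (simp_all add: fps_X_fps_compose_startby0 fps_iterate_nth_0 assms fps_compose_assoc)

lemma fps_iterate_mult:
  fixes g :: "'a::idom fps"
  assumes "g $ 0 = 0"
  shows "fps_iterate (m * n) g = fps_iterate m (fps_iterate n g)"
  by (induction m) (simp_all add: fps_iterate_add assms)

lemma fps_iterate_commute:
  fixes g :: "'a::idom fps"
  assumes "g $ 0 = 0"
  shows "g oo fps_iterate n g = fps_iterate n g oo g"
  using fps_iterate_add[OF assms, of n 1] by simp

lemma funpow_compose_eq_iterate:
  fixes f g :: "'a::idom fps"
  assumes "g $ 0 = 0"
  shows "((\<lambda>f. f oo g) ^^ n) f = f oo fps_iterate n g"
  by (induction n)
     (simp_all add: fps_iterate_commute fps_iterate_nth_0 assms fps_compose_assoc)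

text \<open>Composition with g is the linear operator 1 + T with T = \<open>fps_delta g\<close>, and
  n-fold composition is (1 + T)^n.\<close>

lemma compose_iterate_binomial:
  fixes f g :: "'a::idom fps"
  assumes "g $ 0 = 0"
  shows "f oo fps_iterate n g = (\<Sum>i\<le>n. of_nat (n choose i) * (fps_delta g ^^ i) f)"
proof -
  have "((\<lambda>f. f oo g) ^^ n) f = (\<Sum>i\<le>n. of_nat (n choose i) * (fps_delta g ^^ i) f)"
  proof (induction n)
    case (Suc n)
    let ?D = "\<lambda>i. (fps_delta g ^^ i) f"
    have "((\<lambda>f. f oo g) ^^ Suc n) f = (\<Sum>i\<le>n. of_nat (n choose i) * ?D i) oo g"
      using Suc by simp
    also have "\<dots> = (\<Sum>i\<le>n. of_nat (n choose i) * (?D i oo g))"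
      unfolding fps_compose_sum_distrib
      by (intro sum.cong refl) (simp add: fps_compose_mult_distrib assms flip: fps_of_nat)
    also have "\<dots> = (\<Sum>i\<le>n. of_nat (n choose i) * (?D i + ?D (Suc i)))"
      by (intro sum.cong refl) (simp add: fps_delta_def del: mult_cancel_left)
    also have "\<dots> = (\<Sum>i\<le>n. of_nat (n choose i) * ?D i) + (\<Sum>i\<le>n. of_nat (n choose i) * ?D (Suc i))"
      by (simp only: distrib_left sum.distrib)
    \<comment> \<open>The extra term is zero since n choose n + 1 is zero; it aligns the two sums
      for Pascal's rule.\<close>
    also have "(\<Sum>i\<le>n. of_nat (n choose i) * ?D i) = (\<Sum>i\<le>Suc n. of_nat (n choose i) * ?D i)"
      by (simp add: binomial_eq_0)
    also have "\<dots> = ?D 0 + (\<Sum>i\<le>n. of_nat (n choose Suc i) * ?D (Suc i))"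
      by (subst sum.atMost_Suc_shift) simp
    also have "?D 0 + (\<Sum>i\<le>n. of_nat (n choose Suc i) * ?D (Suc i)) + (\<Sum>i\<le>n. of_nat (n choose i) * ?D (Suc i))
       = (\<Sum>i\<le>Suc n. of_nat (Suc n choose i) * ?D i)"
      by (subst sum.atMost_Suc_shift)
         (simp add: sum.distrib[symmetric] algebra_simps del: funpow.simps sum.atMost_Suc)
    finally show ?case .
  qed simp
  then show ?thesis by (simp add: funpow_compose_eq_iterate assms)
qed

text \<open>In characteristic p the inner binomial coefficients vanish, so (1 + T)^p = 1 +
  T^p.\<close>

lemma fps_delta_iterate_CHAR:
  fixes f g :: "'a::idom fps"
  assumes "g $ 0 = 0" and "prime CHAR('a)"
  shows "fps_delta (fps_iterate CHAR('a) g) f = (fps_delta g ^^ CHAR('a)) f"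
proof -
  let ?p = "CHAR('a)"
  let ?D = "\<lambda>i. (fps_delta g ^^ i) f"
  have "f oo fps_iterate ?p g = (\<Sum>i\<le>?p. of_nat (?p choose i) * ?D i)"
    by (rule compose_iterate_binomial[OF assms(1)])
  also have "\<dots> = (\<Sum>i\<in>{0, ?p}. of_nat (?p choose i) * ?D i)"
  proof (rule sum.mono_neutral_right)
    show "\<forall>i\<in>{..?p} - {0, ?p}. of_nat (?p choose i) * ?D i = 0"
    proof
      fix i assume "i \<in> {..?p} - {0, ?p}"
      then have "?p dvd (?p choose i)"
        using assms(2) by (intro dvd_choose_prime) auto
      then have "(of_nat (?p choose i) :: 'a) = 0"
        by (simp add: of_nat_eq_0_iff_char_dvd)
      then have "(of_nat (?p choose i) :: 'a fps) = 0"
        by (simp flip: fps_of_nat)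
      then show "of_nat (?p choose i) * ?D i = 0" by simp
    qed
  qed auto
  also have "\<dots> = f + ?D ?p"
    using prime_gt_0_nat[OF assms(2)] by simp
  finally show ?thesis by (simp add: fps_delta_def)
qed


section \<open>The orbit of a suitable square under the difference operator\<close>

text \<open>For d = 2, where the coefficients of g at 3, 4, 5 are a_2, a_3, a_4, this is the
  expression of the theorem.\<close>

definition ramification_discriminant :: "nat \<Rightarrow> 'a::field fps \<Rightarrow> 'a" where
  "ramification_discriminant d g =
     (g $ (d + 2)) ^ 2 - g $ (d + 1) * g $ (d + 3) + (if d = 2 then 3 / 2 * (g $ (d + 1)) ^ 3 else 0)"

text \<open>After doubling, the binomial coefficient is a polynomial in \<open>of_nat n\<close>, so
  its value in the field follows from that of n alone.\<close>

lemma double_of_nat_choose_two: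
  "2 * of_nat (n choose 2) = (of_nat n * (of_nat n - 1) :: 'a::comm_ring_1)"
proof -
  have "2 * (n choose 2) + n = n * n"
    by (induction n) (auto simp: numeral_2_eq_2 algebra_simps)
  then have "of_nat (2 * (n choose 2) + n) = (of_nat (n * n) :: 'a)" by simp
  then show ?thesis by (simp add: algebra_simps)
qed

text \<open>Starting in degree 2, the j-th member has its leading term in degree 2 + jd or later. If
  d = 2 in a field of odd characteristic p, the multiplier 2 + 2j of the next step first vanishes at
  j = p - 1, that is, in the last of p steps.\<close>

definition delta_orbit :: "nat \<Rightarrow> 'a::field fps \<Rightarrow> nat \<Rightarrow> 'a fps" where
  "delta_orbit d g j =
     (fps_delta g ^^ j) ((fps_X + fps_const (g $ (d + 2) / g $ (d + 1)) * fps_X ^ 2) ^ 2)"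

text \<open>With \<open>b = B/A\<close> and \<open>m = 2 + jd\<close>, twice the amount by which the third coefficient of the orbit
  deviates from that of the multiple of \<open>(x + b x\<^sup>2)\<^sup>m\<close> with the same leading coefficient.\<close>

definition delta_orbit_defect :: "nat \<Rightarrow> 'a::field fps \<Rightarrow> nat \<Rightarrow> 'a" where
  "delta_orbit_defect d g j = 2 * delta_orbit d g j $ (2 + j * d + 2)
     - (2 + 2 * of_nat j) * (1 + 2 * of_nat j) * (g $ (d + 2) / g $ (d + 1)) ^ 2
       * delta_orbit d g j $ (2 + j * d)"

text \<open>Write m = 2 + 2j, and u for the leading coefficient. If the second one is m b u, as in u
  (x + b x^2)^m, the next pair is m u A and m u b A + (m + 1) m b u A = (m + 2) b (m u A), so the
  shape persists with m + 2.\<close>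

lemma funpow_fps_delta_nth:
  fixes g :: "'a::field fps"
  assumes d: "d \<ge> 2" "of_nat d = (2 :: 'a)"
    and g: "\<forall>j\<le>d. (g - fps_X) $ j = 0"
    and A: "g $ (d + 1) \<noteq> 0"
    and b: "b = g $ (d + 2) / g $ (d + 1)"
  defines "F \<equiv> delta_orbit d g"
  shows "\<And>n. n < 2 + j * d \<Longrightarrow> F j $ n = 0"
    and "F j $ (2 + j * d) = 2 ^ j * of_nat (fact j) * (g $ (d + 1)) ^ j"
    and "F j $ (2 + j * d + 1) = (2 + 2 * of_nat j) * b * F j $ (2 + j * d)"
proof -
  let ?A = "g $ (d + 1)"
  have B: "g $ (d + 2) = b * ?A" using A b by simp
  have "(\<forall>n < 2 + j * d. F j $ n = 0) \<and> F j $ (2 + j * d) = 2 ^ j * of_nat (fact j) * ?A ^ j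
     \<and> F j $ (2 + j * d + 1) = (2 + 2 * of_nat j) * b * F j $ (2 + j * d)"
  proof (induction j)
    case 0
    have "F 0 = fps_X ^ 2 * (1 + fps_const b * fps_X) ^ 2"
      by (simp add: F_def delta_orbit_def b algebra_simps power2_eq_square)
    then have *: "F 0 $ n = (if n < 2 then 0 else ((1 + fps_const b * fps_X) ^ 2) $ (n - 2))" for n
      by (simp add: fps_X_power_mult_nth)
    show ?case
      unfolding * by (simp add: power2_eq_square fps_mult_nth)
  next
    case (Suc j)
    have FS: "F (Suc j) = fps_delta g (F j)" by (simp add: F_def delta_orbit_def)
    have m: "of_nat (2 + j * d) = (2 + 2 * of_nat j :: 'a)"
      "of_nat (2 + j * d + 1) = (3 + 2 * of_nat j :: 'a)" using d by simp_all
    have idx: "2 + Suc j * d = 2 + j * d + d" by simp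
    note L = fps_delta_leading[OF _ g, of "2 + j * d" "F j", folded FS, unfolded m]
    have u: "F (Suc j) $ (2 + j * d + d) = (2 + 2 * of_nat j) * F j $ (2 + j * d) * ?A"
      using Suc d by (intro L) auto
    have v: "F (Suc j) $ (2 + j * d + d + 1) =
       (2 + 2 * of_nat j) * F j $ (2 + j * d) * (b * ?A) + (3 + 2 * of_nat j) * F j $ (2 + j * d + 1) * ?A"
      unfolding B[symmetric] using Suc d by (intro L) auto
    show ?case
    proof (intro conjI allI impI)
      show "F (Suc j) $ n = 0" if "n < 2 + Suc j * d" for n
        using that Suc d by (intro L) auto
      show "F (Suc j) $ (2 + Suc j * d) = 2 ^ Suc j * of_nat (fact (Suc j)) * ?A ^ Suc j"
        unfolding idx u using Suc by (simp add: algebra_simps)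
      have "F j $ (2 + j * d + 1) = (2 + 2 * of_nat j) * b * F j $ (2 + j * d)"
        using Suc by blast
      then show "F (Suc j) $ (2 + Suc j * d + 1) = (2 + 2 * of_nat (Suc j)) * b * F (Suc j) $ (2 + Suc j * d)"
        unfolding idx v u by (simp add: algebra_simps)
    qed
  qed
  then show "\<And>n. n < 2 + j * d \<Longrightarrow> F j $ n = 0" "F j $ (2 + j * d) = 2 ^ j * of_nat (fact j) * ?A ^ j"
     "F j $ (2 + j * d + 1) = (2 + 2 * of_nat j) * b * F j $ (2 + j * d)" by blast+
qed

text \<open>Passing to the defect leaves a scalar recurrence. In characteristic p its inhomogeneous
  factor 2 + 2j vanishes at j = p - 1 and its homogeneous factor 4 + 2j at j = p - 2, so the defect
  after p steps is computable in closed form.\<close>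

lemma funpow_fps_delta_nth_step:
  fixes g :: "'a::field fps"
  assumes d: "d \<ge> 2" "of_nat d = (2 :: 'a)"
    and g: "\<forall>j\<le>d. (g - fps_X) $ j = 0"
    and A: "g $ (d + 1) \<noteq> 0"
    and b: "b = g $ (d + 2) / g $ (d + 1)"
  defines "F \<equiv> delta_orbit d g" and "z \<equiv> delta_orbit_defect d g"
  shows "z (Suc j) = (2 + 2 * of_nat j) * F j $ (2 + j * d) *
      (2 * g $ (d + 3) - 2 * b ^ 2 * g $ (d + 1)
        + (if d = 2 then (1 + 2 * of_nat j) * (g $ (d + 1)) ^ 2 else 0))
      + (4 + 2 * of_nat j) * g $ (d + 1) * z j"
proof -
  let ?A = "g $ (d + 1)"
  let ?m = "2 + 2 * of_nat j :: 'a"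
  have B: "g $ (d + 2) = b * ?A" using A b by simp
  note F = funpow_fps_delta_nth[OF d g A b, folded F_def]
  have FS: "F (Suc j) = fps_delta g (F j)" by (simp add: F_def delta_orbit_def)
  have m: "of_nat (2 + j * d) = ?m" "of_nat (2 + j * d + 1) = ?m + 1"
    "of_nat (2 + j * d + 2) = ?m + 2" using d by simp_all
  have idx: "2 + Suc j * d = 2 + j * d + d" by simp
  note L = fps_delta_leading[OF _ g, of "2 + j * d" "F j", folded FS, unfolded m]
  have u: "F (Suc j) $ (2 + j * d + d) = ?m * F j $ (2 + j * d) * ?A"
    using F(1) d by (intro L) auto
  have ch: "2 * of_nat (2 + j * d choose 2) = ?m * (?m - 1)"
    unfolding double_of_nat_choose_two m ..
  have w: "F (Suc j) $ (2 + j * d + d + 2) = ?m * F j $ (2 + j * d) * g $ (d + 3)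
      + (?m + 1) * F j $ (2 + j * d + 1) * (b * ?A) + (?m + 2) * F j $ (2 + j * d + 2) * ?A
      + (if d = 2 then of_nat (2 + j * d choose 2) * F j $ (2 + j * d) * ?A ^ 2 else 0)"
    unfolding B[symmetric] using F(1) d by (intro L) auto
  \<comment> \<open>Doubling lets \<open>ch\<close> replace the binomial coefficient by a polynomial
    in \<open>?m\<close>.\<close>
  have "2 * F (Suc j) $ (2 + j * d + d + 2) = 2 * ?m * F j $ (2 + j * d) * g $ (d + 3)
      + 2 * (?m + 1) * (?m * b * F j $ (2 + j * d)) * (b * ?A) + (?m + 2) * (2 * F j $ (2 + j * d + 2)) * ?A
      + (if d = 2 then ?m * (?m - 1) * F j $ (2 + j * d) * ?A ^ 2 else 0)"
    unfolding w F(3) ch[symmetric] by (simp add: algebra_simps)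
  then show ?thesis
    unfolding z_def delta_orbit_defect_def F_def[symmetric] b[symmetric] idx u
    by (simp add: algebra_simps power2_eq_square)
qed

section \<open>From a series to its p-th iterate\<close>

lemma two_neq_zero_of_odd_CHAR:
  assumes "prime CHAR('a::semiring_1)" and "odd CHAR('a)"
  shows "(2 :: 'a) \<noteq> 0"
proof
  assume "(2 :: 'a) = 0"
  then have "of_nat 2 = (0 :: 'a)" by simp
  then have "CHAR('a) dvd 2" by (simp only: of_nat_eq_0_iff_char_dvd)
  then have "CHAR('a) = 2" by (rule primes_dvd_imp_eq[OF assms(1) two_is_prime_nat])
  with assms(2) show False by simp
qed

text \<open>Since f = x^2 + ..., the lowest coefficient of \<open>fps_delta h f\<close> is twice
  that of h - x, one degree higher. As \<open>fps_delta h f\<close> is the p-th orbit member, its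
  first two candidate coefficients vanish (the first carries p!, the second is proportional to it)
  and the third decides.\<close>

lemma iterate_CHAR_nth:
  fixes g :: "'a::field fps"
  assumes p: "prime CHAR('a)" "odd CHAR('a)"
    and d: "d \<ge> 2" "of_nat d = (2 :: 'a)"
    and g: "\<forall>j\<le>d. (g - fps_X) $ j = 0"
    and A: "g $ (d + 1) \<noteq> 0"
  defines "h \<equiv> fps_iterate CHAR('a) g"
  shows "\<And>n. n \<le> CHAR('a) * d + 2 \<Longrightarrow> (h - fps_X) $ n = 0"
    and "h $ (CHAR('a) * d + 3) \<noteq> 0 \<longleftrightarrow> ramification_discriminant d g \<noteq> 0"
proof -
  let ?p = "CHAR('a)" and ?A = "g $ (d + 1)"
  have two: "(2 :: 'a) \<noteq> 0" by (rule two_neq_zero_of_odd_CHAR[OF p])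
  define b where "b = g $ (d + 2) / ?A"
  define f where "f = (fps_X + fps_const b * fps_X ^ 2) ^ 2"
  define F where "F = delta_orbit d g"
  define z where "z = delta_orbit_defect d g"
  have F_eq: "F j = (fps_delta g ^^ j) f" for j by (simp add: F_def delta_orbit_def f_def b_def)
  note F = funpow_fps_delta_nth[OF d g A b_def, folded F_def]
  note z = funpow_fps_delta_nth_step[OF d g A b_def, folded F_def z_def]
  \<comment> \<open>With r = p - 2, only the last two steps, from r to p, need to be
    evaluated.\<close>
  obtain r where r: "?p = Suc (Suc r)"
    using prime_ge_2_nat[OF p(1)] by (metis add_2_eq_Suc le_iff_add)
  have "of_nat (Suc (Suc r)) = (0 :: 'a)" unfolding r[symmetric] by simp
  then have r': "of_nat r = (-2 :: 'a)" by (simp add: add_eq_0_iff)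
  have "\<not> ?p dvd fact r" using p(1) r by (simp add: prime_dvd_fact_iff)
  then have "of_nat (fact r) \<noteq> (0 :: 'a)" by (simp only: of_nat_eq_0_iff_char_dvd not_False_eq_True)
  moreover have "(2 :: 'a) ^ r \<noteq> 0" "?A ^ r \<noteq> 0" by (rule power_not_zero[OF two], rule power_not_zero[OF A])
  ultimately have ur: "F r $ (2 + r * d) \<noteq> 0" unfolding F(2) by (simp only: mult_eq_0_iff) blast
  have up: "F ?p $ (2 + ?p * d) = 0" unfolding F(2) r using r' by simp
  have B: "g $ (d + 2) = b * ?A" using A b_def by simp
  \<comment> \<open>The last step loses its inhomogeneous part and multiplies by 2A; the step before
    it forgets all earlier defects because 4 + 2r = 0.\<close>
  have "2 * F ?p $ (2 + ?p * d + 2) = z ?p" unfolding z_def delta_orbit_defect_def F_def[symmetric] up by simp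
  also have "\<dots> = 2 * ?A * z (Suc r)" unfolding r by (subst z) (simp add: r')
  also have "z (Suc r) = -2 * F r $ (2 + r * d) * (2 * g $ (d + 3) - 2 * b ^ 2 * ?A
      - (if d = 2 then 3 * ?A ^ 2 else 0))"
    by (subst z) (simp add: r')
  also have "2 * ?A * \<dots> = 2 * (4 * F r $ (2 + r * d) * ramification_discriminant d g)"
    using two unfolding ramification_discriminant_def B
    by (simp add: field_simps power2_eq_square power3_eq_cube numeral_3_eq_3)
  finally have Fp: "F ?p $ (2 + ?p * d + 2) = 4 * F r $ (2 + r * d) * ramification_discriminant d g"
    using two by (simp only: mult_cancel_left) blast
  have g01: "g $ 0 = 0" "g $ 1 = 1" using g[rule_format, of 0] g[rule_format, of 1] d by auto
  note h01 = fps_iterate_nth_0[OF g01(1), of ?p, folded h_def]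
    fps_iterate_nth_1[OF g01(2), of ?p, folded h_def]
  have f: "f $ 0 = 0" "f $ 1 = 0" "f $ 2 = 1" using F(1)[of 0 0] F(1)[of 1 0] F(2)[of 0]
    by (simp_all add: F_eq)
  then have f': "\<forall>j<2. f $ j = 0" by (auto simp: less_2_cases_iff)
  have hF: "fps_delta h f = F ?p"
    unfolding h_def F_eq by (rule fps_delta_iterate_CHAR[OF g01(1) p(1)])
  have Fp0: "F ?p $ n = 0" if "n < 2 + ?p * d + 2" for n
  proof -
    have "n < 2 + ?p * d \<or> n = 2 + ?p * d \<or> n = 2 + ?p * d + 1" using that by auto
    then show ?thesis using F(1)[of n ?p] up F(3)[of ?p] by (elim disjE) simp_all
  qed
  show hX: "(h - fps_X) $ n = 0" if "n \<le> ?p * d + 2" for n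
  proof (cases "h = fps_X")
    case False
    \<comment> \<open>If h - x has order E, then \<open>fps_delta h f\<close> is nonzero in degree E
      + 1. The p-th orbit member vanishes below degree pd + 4, which forces E \<ge> pd + 3.\<close>
    define E where "E = subdegree (h - fps_X)"
    have E: "(h - fps_X) $ E \<noteq> 0" using False unfolding E_def by (intro nth_subdegree_nonzero) simp
    have "E \<noteq> 0" using h01 E by (cases "E = 0") simp_all
    moreover have "E \<noteq> 1" using h01 E by (cases "E = 1") simp_all
    ultimately have E2: "E \<ge> 2" by linarith
    have lower: "(h - fps_X) $ j = 0" if "j < E" for j
      using that unfolding E_def by (rule nth_less_subdegree_zero)
    have "fps_delta h f $ (2 + (E - 1)) = of_nat 2 * f $ 2 * h $ (E - 1 + 1)"
      using E2 f' lower by (intro fps_delta_leading(2)) (auto simp del: fps_sub_nth)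
    moreover have "(h - fps_X) $ E = h $ E" using E2 by simp
    ultimately have "F ?p $ (2 + (E - 1)) \<noteq> 0" using E2 E two by (simp add: hF f)
    then have "\<not> 2 + (E - 1) < 2 + ?p * d + 2" using Fp0 by blast
    then show ?thesis using that by (intro lower) simp
  qed simp
  have "fps_delta h f $ (2 + (?p * d + 2)) = of_nat 2 * f $ 2 * h $ (?p * d + 2 + 1)"
    using hX f' by (intro fps_delta_leading(2)) (auto simp del: fps_sub_nth)
  then have "fps_delta h f $ (2 + (?p * d + 2)) = 2 * h $ (?p * d + 2 + 1)"
    unfolding f by simp
  then have "2 * h $ (?p * d + 3) = F ?p $ (2 + ?p * d + 2)"
    by (simp add: hF numeral_eq_Suc)
  also have "\<dots> = 2 * (2 * F r $ (2 + r * d) * ramification_discriminant d g)"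
    unfolding Fp by simp
  finally have "h $ (?p * d + 3) = 2 * F r $ (2 + r * d) * ramification_discriminant d g"
    using two by (simp only: mult_cancel_left) blast
  then show "h $ (?p * d + 3) \<noteq> 0 \<longleftrightarrow> ramification_discriminant d g \<noteq> 0"
    using ur two by simp
qed

section \<open>Comparing discriminants of commuting series\<close>

text \<open>Commutation reads \<open>fps_delta g (h - fps_X) = fps_delta h (g - fps_X)\<close>. The
  lowest coefficients, in degree d + e + 1, agree automatically; the next two express AB' and AC'
  through A', B, C and A. As e > 2, a quadratic correction can come only from g.\<close>

lemma ramification_discriminant_commuting:
  fixes g h :: "'a::field fps"
  assumes two: "(2 :: 'a) \<noteq> 0"
    and d: "d \<ge> 2" "of_nat d = (2 :: 'a)" and e: "e > 2" "of_nat e = (2 :: 'a)"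
    and g: "\<forall>j\<le>d. (g - fps_X) $ j = 0"
    and h: "\<forall>j\<le>e. (h - fps_X) $ j = 0"
    and comm: "g oo h = h oo g"
  shows "(g $ (d + 1)) ^ 2 * ramification_discriminant e h =
         (h $ (e + 1)) ^ 2 * ramification_discriminant d g"
proof -
  have "g $ 0 = 0" "h $ 0 = 0" using g[rule_format, of 0] h[rule_format, of 0] by simp_all
  then have eq: "fps_delta g (h - fps_X) = fps_delta h (g - fps_X)"
    using comm by (simp add: fps_delta_def fps_compose_sub_distrib fps_X_fps_compose_startby0)
  have gX: "(g - fps_X) $ (d + k) = g $ (d + k)" "(h - fps_X) $ (e + k) = h $ (e + k)" for k
    using d e by simp_all
  have n: "of_nat (d + 1) = (3 :: 'a)" "of_nat (d + 1 + 1) = (4 :: 'a)" "of_nat (d + 1 + 2) = (5 :: 'a)"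
    "of_nat (e + 1) = (3 :: 'a)" "of_nat (e + 1 + 1) = (4 :: 'a)" "of_nat (e + 1 + 2) = (5 :: 'a)"
    using d e by simp_all
  have ch: "2 * of_nat (e + 1 choose 2) = (6 :: 'a)"
    unfolding double_of_nat_choose_two n by simp
  have idx: "d + 1 + 1 = d + 2" "d + 1 + 2 = d + 3" "e + 1 + 1 = e + 2" "e + 1 + 2 = e + 3" by simp_all
  have g': "\<forall>j<d + 1. (g - fps_X) $ j = 0" and h': "\<forall>j<e + 1. (h - fps_X) $ j = 0"
    using g h by (simp_all del: fps_sub_nth)
  have ge1: "1 \<le> d" "1 \<le> e" "2 \<le> e" using d e by simp_all
  let ?A = "g $ (d + 1)" and ?B = "g $ (d + 2)" and ?C = "g $ (d + 3)"
  let ?A' = "h $ (e + 1)" and ?B' = "h $ (e + 2)" and ?C' = "h $ (e + 3)"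
  note G = fps_delta_leading[OF ge1(1) g h', unfolded n, unfolded idx, unfolded gX]
  note H = fps_delta_leading[OF ge1(2) h g', unfolded n, unfolded idx, unfolded gX]
  have sw: "e + 1 + d = d + 1 + e" by simp
  have "3 * ?A' * ?B + 4 * ?B' * ?A = 3 * ?A * ?B' + 4 * ?B * ?A'"
    using G(3)[OF d(1)] H(3)[OF ge1(3)] unfolding eq sw by simp
  then have AB: "?A * ?B' = ?B * ?A'" by (simp add: algebra_simps)
  let ?k = "if d = 2 then of_nat (e + 1 choose 2) * ?A' * ?A ^ 2 else 0"
  have "3 * ?A' * ?C + 4 * ?B' * ?B + 5 * ?C' * ?A + ?k = 3 * ?A * ?C' + 4 * ?B * ?B' + 5 * ?C * ?A'"
    using G(4)[OF d(1)] H(4)[OF ge1(3)] e(1) unfolding eq sw by simp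
  then have "2 * (?A * ?C') = 2 * ?C * ?A' - ?k" by (simp add: algebra_simps)
  \<comment> \<open>The binomial coefficient in \<open>?k\<close> is known only doubled, through
    \<open>ch\<close>; the factors 2 are cancelled in \<open>AC\<close>.\<close>
  then have "2 * (2 * (?A * ?C')) = 2 * (2 * ?C * ?A') - 2 * ?k" by (simp only: right_diff_distrib)
  also have "2 * ?k = (if d = 2 then 6 * ?A' * ?A ^ 2 else 0)" unfolding ch[symmetric] by simp
  also have "(if d = 2 then 6 * ?A' * ?A ^ 2 else 0) = 2 * (2 * (if d = 2 then 3 / 2 * ?A' * ?A ^ 2 else 0))"
    using two by simp
  finally have "2 * (2 * (?A * ?C')) = 2 * (2 * (?C * ?A' - (if d = 2 then 3 / 2 * ?A' * ?A ^ 2 else 0)))"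
    by (simp only: right_diff_distrib mult.assoc)
  then have AC: "?A * ?C' = ?C * ?A' - (if d = 2 then 3 / 2 * ?A' * ?A ^ 2 else 0)"
    using two by (simp only: mult_cancel_left) blast
  have "?A ^ 2 * ramification_discriminant e h = (?A * ?B') ^ 2 - ?A * ?A' * (?A * ?C')"
    using e unfolding ramification_discriminant_def by (simp add: algebra_simps power2_eq_square)
  also have "\<dots> = ?A' ^ 2 * ramification_discriminant d g"
    unfolding AB AC ramification_discriminant_def
    by (simp add: algebra_simps power2_eq_square power3_eq_cube numeral_3_eq_3)
  finally show ?thesis .
qed

section \<open>Ramification numbers as coefficient conditions, and the criterion\<close>

text \<open>Division by \<open>fps_X\<close> is a shift because the constant term is zero, hence the
  index d + 1. The nonzero coefficient excludes the zero series, whose order is infinite.\<close>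

lemma lower_ramification_number_eq_iff:
  fixes g :: "'a::field fps"
  assumes "g $ 0 = 0"
  shows "lower_ramification_number p n g = enat d \<longleftrightarrow>
    (\<forall>j\<le>d. (fps_iterate (p ^ n) g - fps_X) $ j = 0) \<and> (fps_iterate (p ^ n) g - fps_X) $ (d + 1) \<noteq> 0"
proof -
  define h where "h = fps_iterate (p ^ n) g - fps_X"
  have h0: "h $ 0 = 0" by (simp add: h_def fps_iterate_nth_0 assms)
  then have hs: "h = fps_shift 1 h * fps_X" by (intro fps_ext) simp
  have hX: "h / fps_X = fps_shift 1 h"
    by (subst hs) (rule nonzero_mult_div_cancel_right, simp)
  have "fps_ord k = enat d \<longleftrightarrow> (\<forall>j<d. k $ j = 0) \<and> k $ d \<noteq> 0" for k :: "'a fps"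
  proof
    assume "fps_ord k = enat d"
    then have "k \<noteq> 0" "subdegree k = d" by (auto simp: fps_ord_def split: if_splits)
    then show "(\<forall>j<d. k $ j = 0) \<and> k $ d \<noteq> 0"
      using nth_less_subdegree_zero nth_subdegree_nonzero by blast
  next
    assume "(\<forall>j<d. k $ j = 0) \<and> k $ d \<noteq> 0"
    then have "subdegree k = d" "k $ d \<noteq> 0" by (blast intro: subdegreeI)+
    then have "subdegree k = d" "k \<noteq> 0" by auto
    then show "fps_ord k = enat d" by (simp add: fps_ord_def)
  qed
  moreover have "(\<forall>j<d. h $ (j + 1) = 0) \<longleftrightarrow> (\<forall>j\<le>d. h $ j = 0)"
  proof
    assume *: "\<forall>j<d. h $ (j + 1) = 0"
    show "\<forall>j\<le>d. h $ j = 0"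
    proof (intro allI impI)
      fix j assume "j \<le> d"
      then show "h $ j = 0" using * h0 by (cases j) auto
    qed
  qed simp
  ultimately show ?thesis
    by (simp add: lower_ramification_number_def h_def[symmetric] hX)
qed

theorem theorem1:
  fixes p :: nat
    and a :: "nat \<Rightarrow> 'a::field"
    and g :: "'a fps"
  assumes "prime p" and "odd p"
    and "CHAR('a) = p"
    and "g = fps_X * (1 + Abs_fps (\<lambda>j. if j = 0 then 0 else a j))"
  shows "two_ramified p g \<longleftrightarrow>
    a 1 = 0 \<and> a 2 \<noteq> 0 \<and> 3 / 2 * a 2 ^ 3 + a 3 ^ 2 - a 2 * a 4 \<noteq> 0"
proof -
  note p = assms(1,2)[folded assms(3)]
  have two: "(2 :: 'a) \<noteq> 0" by (rule two_neq_zero_of_odd_CHAR[OF p])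
  have gn: "(g - fps_X) $ n = (if n < 2 then 0 else a (n - 1))" for n
    using assms(4) by (auto simp: not_less less_Suc_eq numeral_2_eq_2)
  have gn': "g $ n = a (n - 1)" if "n \<ge> 2" for n using gn[of n] that by simp
  have g0: "g $ 0 = 0" using gn[of 0] by simp
  define d where "d = (\<lambda>n. 2 * (\<Sum>i\<le>n. p ^ i))"
  have d0: "d 0 = 2" by (simp add: d_def)
  \<comment> \<open>This recursion matches the degree bound for p-th iterates and shows that every
    level equals 2 in the field.\<close>
  have dSuc: "d (Suc n) = p * d n + 2" for n
    unfolding d_def by (subst sum.atMost_Suc_shift) (simp add: sum_distrib_left algebra_simps)
  have d2: "of_nat (d n) = (2 :: 'a)" for n
    using assms(3) by (cases n) (auto simp: d0 dSuc)
  have dge: "d n \<ge> 2" for n by (cases n) (auto simp: d0 dSuc)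
  have dgt: "d (Suc n) > 2" for n using dge[of n] prime_gt_0_nat[OF assms(1)] by (simp add: dSuc)
  define G where "G = (\<lambda>n. fps_iterate (p ^ n) g)"
  have G0: "G 0 = g" by (simp add: G_def)
  have GSuc: "G (Suc n) = fps_iterate p (G n)" for n
    by (simp add: G_def fps_iterate_mult g0)
  have Gz: "G n $ 0 = 0" for n
    unfolding G_def by (rule fps_iterate_nth_0[OF g0])
  have comm: "G n oo G (Suc n) = G (Suc n) oo G n" for n
    unfolding GSuc by (rule fps_iterate_commute[OF Gz])
  have GX: "(G n - fps_X) $ (d n + 1) = G n $ (d n + 1)" for n using dge[of n] by simp
  define ram where "ram = (\<lambda>n. (\<forall>j\<le>d n. (G n - fps_X) $ j = 0) \<and> G n $ (d n + 1) \<noteq> 0)"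
  have two_ram: "two_ramified p g \<longleftrightarrow> (\<forall>n. ram n)"
    unfolding two_ramified_def lower_ramification_number_eq_iff[OF g0]
    by (simp only: ram_def GX[symmetric]) (simp only: G_def d_def)
  have step: "ram (Suc n) \<longleftrightarrow> ramification_discriminant (d n) (G n) \<noteq> 0" if "ram n" for n
    using iterate_CHAR_nth[OF p dge d2, of n "G n"] that
    unfolding ram_def assms(3) dSuc GSuc[symmetric] by (simp add: numeral_3_eq_3 del: fps_sub_nth)
  \<comment> \<open>Each level commutes with the next, its p-th iterate, so nonvanishing of the
    discriminant is inherited.\<close>
  have disc: "ramification_discriminant (d (Suc n)) (G (Suc n)) \<noteq> 0" if "ram n" "ram (Suc n)" for n
  proof -
    have "(G n $ (d n + 1)) ^ 2 * ramification_discriminant (d (Suc n)) (G (Suc n)) =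
        (G (Suc n) $ (d (Suc n) + 1)) ^ 2 * ramification_discriminant (d n) (G n)"
      using that unfolding ram_def
      by (intro ramification_discriminant_commuting two dge d2 dgt comm) blast+
    moreover have "ramification_discriminant (d n) (G n) \<noteq> 0" using step that by blast
    moreover have "G (Suc n) $ (d (Suc n) + 1) \<noteq> 0" using that unfolding ram_def by blast
    ultimately show ?thesis by auto
  qed
  have ram0: "ram 0 \<longleftrightarrow> a 1 = 0 \<and> a 2 \<noteq> 0"
  proof -
    have "(\<forall>j\<le>2. (g - fps_X) $ j = 0) \<longleftrightarrow> a 1 = 0"
      unfolding gn by (auto simp: numeral_2_eq_2 le_Suc_eq)
    then show ?thesis unfolding ram_def G0 d0 by (simp add: gn' del: fps_sub_nth)
  qed
  have disc0: "ramification_discriminant 2 g = 3 / 2 * a 2 ^ 3 + a 3 ^ 2 - a 2 * a 4"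
    by (simp add: ramification_discriminant_def gn')
  have "(\<forall>n. ram n) \<longleftrightarrow> ram 0 \<and> ramification_discriminant 2 g \<noteq> 0"
  proof
    assume "\<forall>n. ram n"
    then show "ram 0 \<and> ramification_discriminant 2 g \<noteq> 0" using step[of 0] by (simp add: d0 G0)
  next
    assume R: "ram 0 \<and> ramification_discriminant 2 g \<noteq> 0"
    \<comment> \<open>The discriminant is carried through the induction, since \<open>ram n\<close>
      alone does not give \<open>ram (Suc n)\<close>.\<close>
    have "ram n \<and> ramification_discriminant (d n) (G n) \<noteq> 0" for n
    proof (induction n)
      case 0
      then show ?case using R by (simp add: d0 G0)
    next
      case (Suc n)
      then show ?case using step disc by blast
    qed
    then show "\<forall>n. ram n" by blast
  qed
  then show ?thesis unfolding two_ram ram0 disc0 by blast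
qed

end
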